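(* For all integers $n \ge 0$ and $k \ge 0$, $$\sum_{i=0}^{k}\binom{n+i}{n}_2 \;=\; \sum_{s=0}^{\lfloor k/2 \rfloor} (-1)^{s}\binom{n+k+1}{n+2s+1}_2,$$ where $\binom{m}{l}_2$ denotes the trinomial coefficient.
   Context: For integers $m \ge 0$ and $-m \le l \le m$, the trinomial coefficient $\binom{m}{l}_2$ is the coefficient of $x^{m+l}$ in the expansion of $(1+x+x^2)^m$. Equivalently, $(1+x+x^{-1})^m=\sum_{l=-m}^{m}\binom{m}{l}_2 x^l$. The identity is between integers. *)

theory Defs
  imports Main "HOL-Computational_Algebra.Polynomial"
begin

text \<open>
  The trinomial coefficient is only meaningful for \<open>- m \<le> l \<le> m\<close>. Below this range
  \<open>nat\<close> would truncate the exponent \<open>m + l\<close> to \<open>0\<close>, so the value is set to \<open>0\<close>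
  there explicitly; above it, the coefficient vanishes because the polynomial has degree \<open>2 m\<close>.
\<close>

definition trinomial :: "nat \<Rightarrow> int \<Rightarrow> int" where
  "trinomial m l =
     (if l < - int m then 0 else coeff ([:1, 1, 1:] ^ m) (nat (int m + l)))"

end

theory Submission
  imports Defs
begin

text \<open>
  Put \<open>S m = (\<Sum>s. (-1)^s * trinomial m (n + 2 * s + 1))\<close>, a finite sum. Under the Pascal-type
  recurrence the two outer neighbours telescope, giving \<open>S (m + 1) = S m + trinomial m n\<close>.
  Since \<open>S n = 0\<close>, iterating from \<open>m = n\<close> to \<open>m = n + k + 1\<close> yields the identity.
\<close>

lemma trinomial_of_nat: "trinomial m (int l) = coeff ([:1, 1, 1:] ^ m) (m + l)"
  by (simp add: trinomial_def nat_add_distrib)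

lemma trinomial_eq_0:
  assumes "m < l"
  shows "trinomial m (int l) = 0"
proof -
  have "degree ([:1, 1, 1 :: int:] ^ m) \<le> 2 * m"
    using degree_power_le[of "[:1, 1, 1 :: int:]" m] by simp
  with assms show ?thesis
    unfolding trinomial_of_nat by (intro coeff_eq_0) linarith
qed

text \<open>Compare coefficients in \<open>p ^ Suc m = p * p ^ m\<close> with
  \<open>p = [:1, 1, 1:]\<close>. Centring at \<open>Suc l\<close> keeps all three neighbours
  nonnegative.\<close>

lemma trinomial_Suc_Suc:
  "trinomial (Suc m) (int (Suc l)) =
     trinomial m (int l) + trinomial m (int (Suc l)) + trinomial m (int (l + 2))"
  by (simp only: trinomial_of_nat) simp

lemma alternating_sum_telescope:
  fixes a :: "nat \<Rightarrow> int"
  shows "(\<Sum>s<N. (-1) ^ s * (a s + a (Suc s))) = a 0 - (-1) ^ N * a N"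
  by (induction N) (simp_all add: algebra_simps)

lemma alternating_sum_trinomial_Suc:
  "(\<Sum>s<N. (-1) ^ s * trinomial (Suc m) (int (n + 2 * s + 1))) =
     (\<Sum>s<N. (-1) ^ s * trinomial m (int (n + 2 * s + 1))) +
     trinomial m (int n) - (-1) ^ N * trinomial m (int (n + 2 * N))"
proof -
  \<comment> \<open>The outer neighbours of the odd offset \<open>2 * s + 1\<close> are the even
    offsets \<open>2 * s\<close> and \<open>2 * Suc s\<close>.\<close>
  define a where "a s = trinomial m (int (n + 2 * s))" for s
  have "trinomial (Suc m) (int (n + 2 * s + 1)) =
      trinomial m (int (n + 2 * s + 1)) + (a s + a (Suc s))" for s
    using trinomial_Suc_Suc[of m "n + 2 * s"] by (simp add: a_def algebra_simps)
  then have "(\<Sum>s<N. (-1) ^ s * trinomial (Suc m) (int (n + 2 * s + 1))) =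
      (\<Sum>s<N. (-1) ^ s * trinomial m (int (n + 2 * s + 1))) +
      (\<Sum>s<N. (-1) ^ s * (a s + a (Suc s)))"
    by (simp only: distrib_left[of _ "trinomial m _"] sum.distrib)
  then show ?thesis
    unfolding alternating_sum_telescope by (simp add: a_def)
qed

text \<open>The cutoff \<open>N\<close> is independent of \<open>j\<close>, so it stays fixed during
  the induction.\<close>

lemma sum_trinomial_eq_alternating_sum:
  assumes "j \<le> 2 * N"
  shows "(\<Sum>i<j. trinomial (n + i) (int n)) =
         (\<Sum>s<N. (-1) ^ s * trinomial (n + j) (int (n + 2 * s + 1)))"
  using assms
proof (induction j)
  case 0
  have "trinomial n (int (n + 2 * s + 1)) = 0" for s
    by (rule trinomial_eq_0) simp
  then show ?case
    by (simp del: of_nat_add)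
next
  case (Suc j)
  \<comment> \<open>The boundary term of the telescoping vanishes since
    \<open>j < 2 * N\<close>.\<close>
  have "trinomial (n + j) (int (n + 2 * N)) = 0"
    using Suc.prems by (intro trinomial_eq_0) simp
  with Suc show ?case
    using alternating_sum_trinomial_Suc[of "n + j" n N] by simp
qed

theorem theorem1p3:
  fixes n k :: nat
  shows "(\<Sum>i = 0..k. trinomial (n + i) (int n)) =
         (\<Sum>s = 0..k div 2. (-1) ^ s * trinomial (n + k + 1) (int (n + 2 * s + 1)))"
proof -
  \<comment> \<open>The successors count the terms of the two sums, whose ranges include
    \<open>k\<close> and \<open>k div 2\<close>.\<close>
  have "Suc k \<le> 2 * Suc (k div 2)"
    by presburger
  from sum_trinomial_eq_alternating_sum[OF this, of n] show ?thesis
    by (simp only: atLeast0AtMost lessThan_Suc_atMost) simp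
qed

end
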